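(* Let $m$ be a non-negative integer and $n$ a positive integer. Every complex root $z$ of the box polynomial $B_{m,n}(x)$ satisfies $$\frac{n}{2}\ \le\ |z|\ \le\ \frac{S(m+n,n)}{\left(\frac{n}{2}\right)^{m-1}\cdot\binom{m+n}{n}}.$$
   Context: For non-negative integers $m,n$, the box polynomial is $$B_{m,n}(x)=\sum_{\lambda\subseteq m\times n}\ \prod_{i=1}^{m}(x+\lambda_i),$$ where the sum is over all integer sequences (partitions) $\lambda=(n\ge\lambda_1\ge\lambda_2\ge\cdots\ge\lambda_m\ge 0)$, i.e. partitions with $m$ non-negative parts, each at most $n$ (an empty product is $1$). $S(a,b)$ denotes the Stirling number of the second kind, the number of set partitions of an $a$-element set into $b$ non-empty blocks. *)

theory Defs
  imports
    Complex_Main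
    "HOL-Computational_Algebra.Polynomial"
    "HOL-Combinatorics.Stirling"
begin

text \<open>Trailing zero parts are kept, so every partition in the box is a list of length exactly
  \<open>m\<close>; its entry at index \<open>i < m\<close> is the part written $\lambda_{i+1}$ on paper.\<close>

definition box_partitions :: "nat \<Rightarrow> nat \<Rightarrow> nat list set" where
  "box_partitions m n = {l. length l = m \<and> sorted_wrt (\<ge>) l \<and> (\<forall>k \<in> set l. k \<le> n)}"

lemma finite_box_partitions: "finite (box_partitions m n)"
proof (rule finite_subset)
  show "box_partitions m n \<subseteq> {l. set l \<subseteq> {..n} \<and> length l = m}"
    by (auto simp: box_partitions_def)
qed (simp add: finite_lists_length_eq)

definition box_poly :: "nat \<Rightarrow> nat \<Rightarrow> complex poly" where
  "box_poly m n = (\<Sum>l \<in> box_partitions m n. \<Prod>i<m. [:of_nat (l ! i), 1:])"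

lemma poly_box_poly:
  "poly (box_poly m n) x = (\<Sum>l \<in> box_partitions m n. \<Prod>i<m. (x + of_nat (l ! i)))"
  by (simp add: box_poly_def poly_sum poly_prod add.commute)

end

(* The polynomial B_{m,n} is the complete homogeneous symmetric polynomial h_m(x, x+1, ..., x+n),
   so the forward difference of B_{m+1,n} is (n+1) B_{m,n+1}.  If all roots of p have real part a,
   then |p(z+1)| = |p(z)| forces Re z = a - 1/2, since all factors |z+1-r| lie on the same side of
   the corresponding |z-r|.  Starting from B_{m,0} = x^m, every root of B_{m,n} therefore has real
   part -n/2, which is the lower bound.  The product of the moduli of the m roots is
   |B_{m,n}(0)| divided by the leading coefficient, that is S(m+n,n) / binomial(m+n,n), and bounding
   m-1 of them from below by n/2 gives the upper bound. *)
theory Submission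
  imports Defs "HOL-Computational_Algebra.Fundamental_Theorem_Algebra"
begin

lemma box_poly_0_left [simp]: "box_poly 0 n = 1"
proof -
  have "box_partitions 0 n = {[]}" by (auto simp: box_partitions_def)
  then show ?thesis by (simp add: box_poly_def)
qed

lemma box_poly_0_right: "box_poly m 0 = [:0, 1:] ^ m"
proof -
  have "box_partitions m 0 = {replicate m 0}"
    by (auto simp: box_partitions_def sorted_wrt_iff_nth_less replicate_length_same[symmetric])
  then show ?thesis by (simp add: box_poly_def)
qed

text \<open>The head is the largest part: either it equals \<open>Suc n\<close> and can be stripped,
  or every part is at most \<open>n\<close>.\<close>

lemma box_partitions_Suc_Suc:
  "box_partitions (Suc m) (Suc n) =
     box_partitions (Suc m) n \<union> (#) (Suc n) ` box_partitions m (Suc n)"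
proof (intro set_eqI iffI)
  fix l assume l: "l \<in> box_partitions (Suc m) (Suc n)"
  then obtain x l' where [simp]: "l = x # l'" by (cases l) (auto simp: box_partitions_def)
  show "l \<in> box_partitions (Suc m) n \<union> (#) (Suc n) ` box_partitions m (Suc n)"
  proof (cases "x = Suc n")
    case True
    with l show ?thesis by (auto simp: box_partitions_def)
  next
    case False
    with l show ?thesis by (force simp: box_partitions_def)
  qed
next
  fix l assume "l \<in> box_partitions (Suc m) n \<union> (#) (Suc n) ` box_partitions m (Suc n)"
  then show "l \<in> box_partitions (Suc m) (Suc n)"
    by (auto simp: box_partitions_def le_Suc_eq)
qed

text \<open>This is the recurrence of complete homogeneous polynomials on adjoining the variable x +
  n + 1. Both terms on the right have a smaller index sum, hence the inductions on
  \<open>m + n\<close> below.\<close>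

lemma box_poly_Suc_Suc:
  "box_poly (Suc m) (Suc n) =
     box_poly (Suc m) n + [:of_nat (Suc n), 1:] * box_poly m (Suc n)"
proof -
  have "box_partitions (Suc m) n \<inter> (#) (Suc n) ` box_partitions m (Suc n) = {}"
    by (auto simp: box_partitions_def)
  then have "box_poly (Suc m) (Suc n) = box_poly (Suc m) n +
      (\<Sum>l \<in> (#) (Suc n) ` box_partitions m (Suc n). \<Prod>i<Suc m. [:of_nat (l ! i), 1:])"
    unfolding box_poly_def box_partitions_Suc_Suc
    by (intro sum.union_disjoint) (auto simp: finite_box_partitions)
  also have "(\<Sum>l \<in> (#) (Suc n) ` box_partitions m (Suc n). \<Prod>i<Suc m. [:of_nat (l ! i), 1:]) =
      (\<Sum>l \<in> box_partitions m (Suc n). \<Prod>i<Suc m. [:of_nat ((Suc n # l) ! i), 1:])"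
    by (subst sum.reindex) auto
  also have "\<dots> = [:of_nat (Suc n), 1:] * box_poly m (Suc n)"
    unfolding box_poly_def prod.lessThan_Suc_shift sum_distrib_left by simp
  finally show ?thesis .
qed

lemma degree_box_poly_le: "degree (box_poly m n) \<le> m"
proof (induction "m + n" arbitrary: m n)
  case (Suc k)
  show ?case
  proof (cases m; cases n)
    fix m' n' assume [simp]: "m = Suc m'" "n = Suc n'"
    have "degree (box_poly m' n) \<le> m'" "degree (box_poly m n') \<le> m"
      using Suc by auto
    then show ?thesis unfolding \<open>m = Suc m'\<close> \<open>n = Suc n'\<close> box_poly_Suc_Suc
      by (intro degree_add_le order.trans[OF degree_mult_le]) auto
  qed (auto simp: box_poly_0_right degree_power_eq)
qed auto

text \<open>In the coefficient of x^m the recurrence becomes Pascal's rule.\<close>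

lemma coeff_box_poly: "coeff (box_poly m n) m = of_nat ((m + n) choose n)"
proof (induction "m + n" arbitrary: m n)
  case (Suc k)
  show ?case
  proof (cases m; cases n)
    fix m' n' assume [simp]: "m = Suc m'" "n = Suc n'"
    have "coeff (box_poly m' n) m' = of_nat ((m' + n) choose n)"
      "coeff (box_poly m n') m = of_nat ((m + n') choose n')"
      using Suc by auto
    \<comment> \<open>This removes the contribution of the constant term of the linear
      factor.\<close>
    moreover have "coeff (box_poly m' n) m = 0"
      using degree_box_poly_le[of m' n] by (simp add: coeff_eq_0)
    ultimately show ?thesis
      by (simp add: box_poly_Suc_Suc)
  qed (use lead_coeff_power[of "[:0, 1:] :: complex poly" m] in
      \<open>auto simp: box_poly_0_right degree_power_eq\<close>)
qed auto

lemma degree_box_poly: "degree (box_poly m n) = m"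
  by (intro antisym degree_box_poly_le le_degree) (simp add: coeff_box_poly)

text \<open>At x = 0 the factor x + n + 1 becomes n + 1, and the recurrence is that of the Stirling
  numbers.\<close>

lemma poly_box_poly_0: "poly (box_poly m n) 0 = of_nat (Stirling (m + n) n)"
proof (induction "m + n" arbitrary: m n)
  case (Suc k)
  show ?case
  proof (cases m; cases n)
    fix m' n' assume [simp]: "m = Suc m'" "n = Suc n'"
    have "poly (box_poly m' n) 0 = of_nat (Stirling (m' + n) n)"
      "poly (box_poly m n') 0 = of_nat (Stirling (m + n') n')"
      using Suc by auto
    then show ?thesis
      by (simp add: box_poly_Suc_Suc algebra_simps)
  qed (auto simp: box_poly_0_right)
qed auto

lemma box_poly_difference:
  "poly (box_poly (Suc m) n) (x + 1) - poly (box_poly (Suc m) n) x =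
     of_nat (Suc n) * poly (box_poly m (Suc n)) x"
proof (induction "m + n" arbitrary: m n)
  case 0
  then show ?case by (simp add: box_poly_0_right)
next
  case (Suc k)
  show ?case
  proof (cases m; cases n)
    fix m' n' assume [simp]: "m = Suc m'" "n = Suc n'"
    have IH: "poly (box_poly (Suc m') n) (x + 1) = poly (box_poly (Suc m') n) x +
        of_nat (Suc n) * poly (box_poly m' (Suc n)) x"
      "poly (box_poly (Suc m) n') (x + 1) = poly (box_poly (Suc m) n') x +
        of_nat (Suc n') * poly (box_poly m (Suc n')) x"
      using Suc.hyps(1)[of m' n] Suc.hyps(1)[of m n'] Suc.hyps(2)
      by (auto simp: algebra_simps)
    \<comment> \<open>With D the forward difference, D((x + n) f) = f + (x + n + 1) D f. For f =
      B_{m,n} the two hypotheses give D B_{m+1,n} = n B_{m,n} + B_{m,n} + (x + n + 1)(n + 1)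
      B_{m-1,n+1}, which the recurrence collapses to (n + 1) B_{m,n+1}. The instances of the
      recurrence leave B_{m,n} itself folded.\<close>
    show ?thesis
      using IH by (simp add: box_poly_Suc_Suc[of "Suc m'"] box_poly_Suc_Suc[of m' "Suc n'"] algebra_simps)
  next
    fix m' assume [simp]: "m = Suc m'" "n = 0"
    have "poly (box_poly m 0) (x + 1) = poly (box_poly m 0) x + poly (box_poly m' 1) x"
      using Suc.hyps(1)[of m' 0] Suc.hyps(2) by (simp add: algebra_simps)
    then show ?thesis
      by (simp add: box_poly_Suc_Suc box_poly_0_right algebra_simps)
  next
    fix n' assume [simp]: "m = 0" "n = Suc n'"
    have "poly (box_poly 1 n') (x + 1) = poly (box_poly 1 n') x + of_nat n"
      using Suc.hyps(1)[of 0 n'] Suc.hyps(2) by (simp add: algebra_simps)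
    then show ?thesis
      by (simp add: box_poly_Suc_Suc algebra_simps)
  qed (use Suc in auto)
qed


lemma Re_eq_of_poly_shift_eq:
  fixes p :: "complex poly"
  assumes roots: "\<And>r. poly p r = 0 \<Longrightarrow> Re r = a"
    and deg: "degree p > 0"
    and eq: "poly p (z + 1) = poly p z"
  shows "Re z = a - 1 / 2"
proof -
  obtain r where r: "smult (lead_coeff p) (\<Prod>i<degree p. [:- r i, 1:]) = p"
    by (rule complex_poly_decompose')
  have lc: "lead_coeff p \<noteq> 0"
    using deg by auto
  have eval: "poly p x = lead_coeff p * (\<Prod>i<degree p. x - r i)" for x
    by (subst r [symmetric]) (simp add: poly_prod)
  have Re_r: "Re (r i) = a" if "i < degree p" for i
    using that by (intro roots) (auto simp: eval)
  have "cmod (poly p (z + 1)) = cmod (poly p z)"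
    by (simp only: eq)
  then have prods: "(\<Prod>i<degree p. cmod (z + 1 - r i)) = (\<Prod>i<degree p. cmod (z - r i))"
    unfolding eval norm_mult prod_norm[symmetric] using lc by simp
  \<comment> \<open>|w + 1|^2 = |w|^2 + 2 Re w + 1 with Re w = Re z - a: the increment is the same
    for every root.\<close>
  have cmod_sq: "cmod (z + 1 - r i) ^ 2 = cmod (z - r i) ^ 2 + 2 * (Re z - (a - 1 / 2))"
    if "i < degree p" for i
    unfolding cmod_power2 using Re_r[OF that] by (simp add: power2_eq_square algebra_simps)
  show ?thesis
  proof (cases "Re z" "a - 1 / 2" rule: linorder_cases)
    case less
    have "cmod (z + 1 - r i) < cmod (z - r i)" if "i < degree p" for i
      by (rule power2_less_imp_less[OF _ norm_ge_zero])
        (use less in \<open>simp only: cmod_sq[OF that] add_less_same_cancel1, simp\<close>)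
    \<comment> \<open>Strictness needs some index, here 0, which exists by \<open>deg\<close>, and
      positive larger factors, which hold as each exceeds a norm.\<close>
    then have "(\<Prod>i<degree p. cmod (z + 1 - r i)) < (\<Prod>i<degree p. cmod (z - r i))"
      using deg by (intro prod_mono_strict[of 0])
        (auto intro: less_imp_le le_less_trans[OF norm_ge_zero] simp del: zero_less_norm_iff)
    with prods show ?thesis by simp
  next
    case greater
    have "cmod (z - r i) < cmod (z + 1 - r i)" if "i < degree p" for i
      by (rule power2_less_imp_less[OF _ norm_ge_zero])
        (use greater in \<open>simp only: cmod_sq[OF that] less_add_same_cancel1, simp\<close>)
    then have "(\<Prod>i<degree p. cmod (z - r i)) < (\<Prod>i<degree p. cmod (z + 1 - r i))"
      using deg by (intro prod_mono_strict[of 0])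
        (auto intro: less_imp_le le_less_trans[OF norm_ge_zero] simp del: zero_less_norm_iff)
    with prods show ?thesis by simp
  qed
qed

lemma Re_root_box_poly:
  assumes "poly (box_poly m n) z = 0"
  shows "Re z = - real n / 2"
  using assms
proof (induction n arbitrary: m z)
  case 0
  then show ?case by (auto simp: box_poly_0_right)
next
  case (Suc n)
  \<comment> \<open>Lowering \<open>Suc n\<close> to \<open>n\<close> raises \<open>m\<close>, so
    the induction needs \<open>m\<close> arbitrary; it also makes the degree positive.\<close>
  have "poly (box_poly (Suc m) n) (z + 1) = poly (box_poly (Suc m) n) z"
    using box_poly_difference[of m n z] Suc.prems by simp
  then have "Re z = - real n / 2 - 1 / 2"
    by (intro Re_eq_of_poly_shift_eq[of "box_poly (Suc m) n"] Suc.IH) (auto simp: degree_box_poly)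
  then show ?case by (simp add: field_simps)
qed

lemma cmod_root_mult_power_le:
  fixes p :: "complex poly"
  assumes roots: "\<And>r. poly p r = 0 \<Longrightarrow> c \<le> cmod r"
    and c: "0 \<le> c"
    and z: "poly p z = 0"
  shows "cmod (lead_coeff p) * (cmod z * c ^ (degree p - 1)) \<le> cmod (poly p 0)"
proof (cases "p = 0")
  case False
  obtain r where r: "smult (lead_coeff p) (\<Prod>i<degree p. [:- r i, 1:]) = p"
    by (rule complex_poly_decompose')
  have eval: "poly p x = lead_coeff p * (\<Prod>i<degree p. x - r i)" for x
    by (subst r [symmetric]) (simp add: poly_prod)
  have r_ge: "c \<le> cmod (r i)" if "i < degree p" for i
    using that by (intro roots) (auto simp: eval)
  \<comment> \<open>Only one occurrence of \<open>z\<close> among the roots is split off; any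
    further copies are bounded below by \<open>c\<close> like the rest.\<close>
  obtain j where j: "j < degree p" "z = r j"
    using z False by (auto simp: eval)
  have "c ^ (degree p - 1) = (\<Prod>i\<in>{..<degree p} - {j}. c)"
    using j by simp
  also have "\<dots> \<le> (\<Prod>i\<in>{..<degree p} - {j}. cmod (r i))"
    using c r_ge by (intro prod_mono) auto
  finally have "cmod z * c ^ (degree p - 1) \<le> cmod (r j) * (\<Prod>i\<in>{..<degree p} - {j}. cmod (r i))"
    unfolding \<open>z = r j\<close> by (intro mult_left_mono norm_ge_zero)
  also have "\<dots> = (\<Prod>i<degree p. cmod (r i))"
    using j by (subst prod.remove[of "{..<degree p}" j]) auto
  finally have "cmod (lead_coeff p) * (cmod z * c ^ (degree p - 1)) \<le>
      cmod (lead_coeff p) * (\<Prod>i<degree p. cmod (r i))"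
    by (rule mult_left_mono) simp
  also have "\<dots> = cmod (poly p 0)"
    unfolding eval norm_mult prod_norm[symmetric] by simp
  finally show ?thesis .
qed auto

theorem theorem7p7:
  fixes m n :: nat and z :: complex
  assumes "n > 0"
    and "poly (box_poly m n) z = 0"
  shows "real n / 2 \<le> cmod z \<and>
    cmod z \<le> real (Stirling (m + n) n) /
      ((real n / 2) powi (int m - 1) * real ((m + n) choose n))"
proof
  have lower: "real n / 2 \<le> cmod r" if "poly (box_poly m n) r = 0" for r
    using Re_root_box_poly[OF that] abs_Re_le_cmod[of r] by simp
  then show "real n / 2 \<le> cmod z"
    using assms by simp
  \<comment> \<open>For m = 0 the polynomial is 1 and has no root. So the integer exponent m - 1 is
    non-negative and agrees with truncated subtraction.\<close>
  have "m > 0"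
    using assms by (cases m) auto
  then have powi: "(real n / 2) powi (int m - 1) = (real n / 2) ^ (m - 1)"
    by (simp add: power_int_def nat_diff_distrib)
  have "real ((m + n) choose n) * (cmod z * (real n / 2) ^ (m - 1)) \<le> real (Stirling (m + n) n)"
    using cmod_root_mult_power_le[of "box_poly m n" "real n / 2" z, OF lower] assms(2)
    by (simp add: degree_box_poly coeff_box_poly poly_box_poly_0)
  moreover have "(real n / 2) ^ (m - 1) * real ((m + n) choose n) > 0"
    using assms by simp
  ultimately show "cmod z \<le> real (Stirling (m + n) n) /
      ((real n / 2) powi (int m - 1) * real ((m + n) choose n))"
    unfolding powi by (subst pos_le_divide_eq) (simp_all only: mult_ac)
qed

end
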